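(* Let $n$ and $d$ be positive integers with $d \le n$. Then $$ A_2(n,d) \ \ge\ \frac{2^n}{V(n,d-1)}\cdot \frac{\log_2 V(n,d-1) \;-\; \log_2\sqrt{e(n,d-1)}}{10}, $$ where $V$ and $e$ are as defined in the context.
   Context: $A_2(n,d)$ denotes the maximum number of codewords in a binary code of length $n$ and minimum Hamming distance $d$. $V(n,r)=\sum_{i=0}^{r}\binom{n}{i}$ is the volume of a Hamming sphere of radius $r$ in $\{0,1\}^n$. For $x\in\mathbb{R}$, $\lceil x\rceil^+$ denotes the smallest nonnegative integer $m$ with $m\ge x$. For positive integers $n$ and $r$ with $r\le n$, $$ e(n,r)=\frac{1}{6}\sum_{w=1}^{r}\binom{n}{w}\left(\sum_{i=1}^{r}\ \sum_{j=\lceil (w+i-r)/2\rceil^+}^{\min\{w,i\}}\binom{w}{j}\binom{n-w}{i-j}\;-\;1\right). $$ *)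

theory Defs
  imports Complex_Main
begin

text \<open>Binary words of length \<open>n\<close> are the boolean lists of length \<open>n\<close>.\<close>

definition binary_words :: "nat \<Rightarrow> bool list set" where
  "binary_words n = {x. length x = n}"

definition hamming_dist :: "bool list \<Rightarrow> bool list \<Rightarrow> nat" where
  "hamming_dist x y = card {k. k < length x \<and> x ! k \<noteq> y ! k}"

definition min_dist :: "bool list set \<Rightarrow> nat" where
  "min_dist C = Min {hamming_dist x y | x y. x \<in> C \<and> y \<in> C \<and> x \<noteq> y}"

text \<open>
  The condition \<open>2 \<le> card C\<close> keeps the minimum in \<open>min_dist\<close> over a nonempty set.
  The minimum distance is required to be exactly \<open>d\<close>.
\<close>

definition binary_code :: "nat \<Rightarrow> nat \<Rightarrow> bool list set \<Rightarrow> bool" where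
  "binary_code n d C \<longleftrightarrow> C \<subseteq> binary_words n \<and> 2 \<le> card C \<and> min_dist C = d"

text \<open>
  For \<open>1 \<le> d \<le> n\<close> the set below is finite and nonempty, so \<open>Max\<close> is meaningful; outside
  this range the value is unspecified.
\<close>

definition A2 :: "nat \<Rightarrow> nat \<Rightarrow> nat" where
  "A2 n d = Max (card ` {C. binary_code n d C})"

definition V :: "nat \<Rightarrow> nat \<Rightarrow> nat" where
  "V n r = (\<Sum>i = 0..r. n choose i)"

definition ceiling_nonneg :: "real \<Rightarrow> nat" where
  "ceiling_nonneg x = (LEAST m. x \<le> real m)"

text \<open>
  The natural-number subtractions \<open>n - w\<close> and \<open>i - j\<close> do not truncate when \<open>r \<le> n\<close>.
  Note that \<open>e n 0 = e n 1 = 0\<close>, so \<open>log 2 (sqrt (e n r))\<close> takes the default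
  value \<open>0\<close> for \<open>r \<le> 1\<close>.
\<close>

definition e :: "nat \<Rightarrow> nat \<Rightarrow> real" where
  "e n r = 1 / 6 * (\<Sum>w = 1..r. real (n choose w) *
     ((\<Sum>i = 1..r. \<Sum>j = ceiling_nonneg ((real w + real i - real r) / 2)..min w i.
         real (w choose j) * real ((n - w) choose (i - j))) - 1))"

end

theory Submission
  imports Defs
begin

text \<open>
  Join distinct words at distance at most \<open>r = d - 1\<close>; a code with minimum distance at least
  \<open>d\<close> is an independent set of this graph. Every vertex has \<open>V - 1\<close> neighbours, which span
  \<open>3 e\<close> edges. Put \<open>L = log 2 (V / sqrt e)\<close>. If \<open>L \<le> 10\<close>, a maximum independent set, being
  dominating, is large enough. Otherwise draw an independent set \<open>I\<close> with probability proportional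
  to \<open>l ^ card I\<close> (the hard-core model), where \<open>l = 1 / (8 * sqrt e)\<close>. Conditioned on \<open>I\<close> outside
  the closed neighbourhood of \<open>v\<close>, either \<open>I\<close> contains \<open>v\<close>, or it is a hard-core sample on the
  set \<open>S\<close> of unblocked neighbours. If \<open>l * card S\<close> is small, then \<open>v \<in> I\<close> is likely; if it is
  large, then \<open>I\<close> contains many neighbours of \<open>v\<close>, because \<open>S\<close> spans few edges. In both cases
  the expectation of \<open>V * [v \<in> I] + card (N v \<inter> I)\<close> is at least \<open>L / 5\<close>, while the sum of these
  quantities over all \<open>v\<close> is at most \<open>2 * V * card I\<close>.
\<close>

section \<open>The hard-core model\<close>

text \<open>At \<open>L = 10\<close> the sides are about 110 and 128, and from there the right side
  grows faster because 2/5 < ln 2. This serves the case of few unblocked neighbours, where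
  \<open>exp (2 / 5 * L)\<close> bounds the partition function and 1/3 bounds
  \<open>l\<close>.\<close>

lemma exp_vs_two_powr:
  fixes L :: real
  assumes "10 \<le> L"
  shows "L / 5 * (1 / 3 + exp (2 / 5 * L)) \<le> 2 powr L / 8"
proof -
  define y where "y = L - 10"
  have y: "0 \<le> y" and L: "L = 10 + y" using assms by (auto simp: y_def)
  have e1: "exp 1 \<le> (11 / 4 :: real)"
  proof -
    have "exp 1 = exp (1 / 64 :: real) ^ 64" by (simp flip: exp_of_nat_mult)
    \<comment> \<open>The quadratic bound on \<open>exp\<close> loses little at 1/64: the power is
      about 2.74, just below 11/4.\<close>
    also have "\<dots> \<le> (1 + 1 / 64 + (1 / 64)\<^sup>2) ^ 64"
      by (intro power_mono exp_bound) auto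
    also have "\<dots> \<le> 11 / 4" by (simp add: power2_eq_square power_divide)
    finally show ?thesis .
  qed
  \<comment> \<open>The value 173/3 is chosen so that adding 1/3 gives 58.\<close>
  have e4: "exp 4 \<le> (173 / 3 :: real)"
  proof -
    have "exp 4 = exp (1 :: real) ^ 4" by (simp flip: exp_of_nat_mult)
    also have "\<dots> \<le> (11 / 4) ^ 4" using e1 by (intro power_mono) auto
    also have "\<dots> \<le> 173 / 3" by (simp add: power_divide)
    finally show ?thesis .
  qed
  have ln2: "2 / 3 \<le> ln (2 :: real)"
  proof -
    have "exp 2 = exp (1 :: real) ^ 2" by (simp flip: exp_of_nat_mult)
    also have "\<dots> \<le> (11 / 4) ^ 2" using e1 by (intro power_mono) auto
    also have "\<dots> \<le> 2 ^ 3" by (simp add: power_divide)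
    finally have "2 \<le> ln (2 ^ 3 :: real)" by (subst ln_ge_iff) auto
    then show ?thesis by (simp only: ln_realpow)
  qed
  have "exp (2 / 5 * L) = exp 4 * exp (2 / 5 * y)" unfolding L by (simp flip: exp_add)
  also have "\<dots> \<le> 173 / 3 * exp (2 / 5 * y)" using e4 by simp
  finally have "exp (2 / 5 * L) \<le> 173 / 3 * exp (2 / 5 * y)" .
  moreover have "1 \<le> exp (2 / 5 * y)" using y by simp
  ultimately have "1 / 3 + exp (2 / 5 * L) \<le> 58 * exp (2 / 5 * y)" by linarith
  then have "L / 5 * (1 / 3 + exp (2 / 5 * L)) \<le> L / 5 * (58 * exp (2 / 5 * y))"
    using assms by (intro mult_left_mono) auto
  also have "\<dots> = (116 + 58 / 5 * y) * exp (2 / 5 * y)" by (simp add: L algebra_simps)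
  \<comment> \<open>128 is the right side of the claim at \<open>y = 0\<close>. Absorbing the linear
    factor into \<open>exp (y / 4)\<close> raises the rate to 13/20, still below 2/3.\<close>
  also have "\<dots> \<le> 128 * exp (y / 4) * exp (2 / 5 * y)"
    using exp_ge_add_one_self[of "y / 4"] y by (intro mult_right_mono) (linarith, simp)
  also have "\<dots> = 128 * exp (13 / 20 * y)" by (simp add: mult.assoc flip: exp_add)
  also have "\<dots> \<le> 128 * exp (ln 2 * y)"
    using y ln2 by (intro mult_left_mono exp_le_cancel_iff[THEN iffD2] mult_right_mono) auto
  also have "\<dots> = 2 powr L / 8"
    by (simp add: L powr_add powr_def[of 2 y] mult.commute powr_numeral)
  finally show ?thesis .
qed

section \<open>Partition function and expected size of hard-core samples\<close>

locale sym_rel =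
  fixes E :: "'a \<Rightarrow> 'a \<Rightarrow> bool"
  assumes E_sym: "E x y \<Longrightarrow> E y x" and E_irrefl: "\<not> E x x"
begin

definition indep :: "'a set \<Rightarrow> bool" where
  "indep I \<longleftrightarrow> (\<forall>x\<in>I. \<forall>y\<in>I. \<not> E x y)"

definition indeps :: "'a set \<Rightarrow> 'a set set" where
  "indeps S = {I. I \<subseteq> S \<and> indep I}"

text \<open>The partition function \<open>Z\<close> and \<open>l * Z'\<close>: the expected size is \<open>hc_size / hc_sum\<close>.\<close>

definition hc_sum :: "real \<Rightarrow> 'a set \<Rightarrow> real" where
  "hc_sum l S = (\<Sum>I\<in>indeps S. l ^ card I)"

definition hc_size :: "real \<Rightarrow> 'a set \<Rightarrow> real" where
  "hc_size l S = (\<Sum>I\<in>indeps S. l ^ card I * real (card I))"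

lemma finite_indeps: "finite S \<Longrightarrow> finite (indeps S)"
  by (auto simp: indeps_def)

lemma indeps_mono: "A \<subseteq> B \<Longrightarrow> indeps A \<subseteq> indeps B"
  by (auto simp: indeps_def)

lemma hc_sum_pos:
  assumes "finite S" "0 \<le> l"
  shows "1 \<le> hc_sum l S"
proof -
  have "(\<Sum>I\<in>{{} :: 'a set}. l ^ card I) \<le> hc_sum l S"
    unfolding hc_sum_def using assms
    by (intro sum_mono2 finite_indeps) (auto simp: indeps_def indep_def)
  then show ?thesis by simp
qed

text \<open>Removing \<open>u\<close> maps these sets bijectively onto the independent sets that
  avoid \<open>u\<close> and its neighbours, and costs one factor \<open>l\<close>.\<close>

lemma hc_sum_containing:
  assumes "finite S" "u \<in> S"
  shows "(\<Sum>I\<in>{I\<in>indeps S. u \<in> I}. l ^ card I) = l * hc_sum l {w\<in>S. w \<noteq> u \<and> \<not> E u w}"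
proof -
  let ?R = "indeps {w\<in>S. w \<noteq> u \<and> \<not> E u w}"
  have img: "{I\<in>indeps S. u \<in> I} = insert u ` ?R"
  proof (intro set_eqI iffI)
    fix I assume I: "I \<in> {I\<in>indeps S. u \<in> I}"
    then have "I = insert u (I - {u})" by auto
    moreover have "I - {u} \<in> ?R"
      using I by (auto simp: indeps_def indep_def)
    ultimately show "I \<in> insert u ` ?R" by blast
  next
    fix I assume "I \<in> insert u ` ?R"
    then show "I \<in> {I\<in>indeps S. u \<in> I}"
      using assms E_irrefl by (auto simp: indeps_def indep_def dest: E_sym)
  qed
  have inj: "inj_on (insert u) ?R"
    by (rule inj_onI) (auto simp: indeps_def insert_ident)
  have "(\<Sum>I\<in>{I\<in>indeps S. u \<in> I}. l ^ card I) = (\<Sum>I\<in>?R. l ^ card (insert u I))"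
    unfolding img by (simp add: sum.reindex[OF inj])
  also have "\<dots> = (\<Sum>I\<in>?R. l * l ^ card I)"
  proof (rule sum.cong[OF refl])
    fix I assume "I \<in> ?R"
    then have "finite I" "u \<notin> I" using assms by (auto simp: indeps_def intro: finite_subset)
    then show "l ^ card (insert u I) = l * l ^ card I" by simp
  qed
  finally show ?thesis by (simp add: hc_sum_def sum_distrib_left)
qed

lemma hc_sum_mono:
  assumes "finite B" "A \<subseteq> B" "0 \<le> l"
  shows "hc_sum l A \<le> hc_sum l B"
  unfolding hc_sum_def using assms
  by (intro sum_mono2 finite_indeps indeps_mono) auto

text \<open>If \<open>w\<close> is new, the sets containing it contribute \<open>l\<close> times the
  partition function of a subset of \<open>A\<close>.\<close>

lemma hc_sum_insert_le:
  assumes "finite A" "0 \<le> l"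
  shows "hc_sum l (insert w A) \<le> (1 + l) * hc_sum l A"
proof (cases "w \<in> A")
  case True
  then have "insert w A = A" by blast
  moreover have "0 \<le> l * hc_sum l A" using hc_sum_pos[OF assms] assms by simp
  ultimately show ?thesis by (simp add: algebra_simps)
next
  case False
  have "indeps (insert w A) = indeps A \<union> {I\<in>indeps (insert w A). w \<in> I}"
    by (auto simp: indeps_def)
  moreover have "indeps A \<inter> {I\<in>indeps (insert w A). w \<in> I} = {}"
    using False by (auto simp: indeps_def)
  ultimately have "hc_sum l (insert w A)
      = hc_sum l A + (\<Sum>I\<in>{I\<in>indeps (insert w A). w \<in> I}. l ^ card I)"
    unfolding hc_sum_def using assms finite_indeps
    by (metis (no_types, lifting) finite_Un finite_insert sum.union_disjoint)
  also have "\<dots> = hc_sum l A + l * hc_sum l {u\<in>insert w A. u \<noteq> w \<and> \<not> E w u}"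
    using assms by (simp add: hc_sum_containing)
  also have "\<dots> \<le> hc_sum l A + l * hc_sum l A"
    using assms by (intro add_left_mono mult_left_mono hc_sum_mono) auto
  finally show ?thesis by (simp add: algebra_simps)
qed

lemma hc_sum_Un_le:
  assumes "finite B" "finite D" "0 \<le> l"
  shows "hc_sum l (B \<union> D) \<le> (1 + l) ^ card D * hc_sum l B"
  using assms(2)
proof (induction D)
  case (insert w D)
  have "hc_sum l (B \<union> insert w D) \<le> (1 + l) * hc_sum l (B \<union> D)"
    using hc_sum_insert_le[of "B \<union> D" l w] insert assms by simp
  also have "\<dots> \<le> (1 + l) * ((1 + l) ^ card D * hc_sum l B)"
    using insert assms by (intro mult_left_mono) auto
  finally show ?case using insert by (simp add: mult.assoc)
qed simp

lemma hc_sum_le_exp: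
  assumes "finite S" "0 \<le> l"
  shows "hc_sum l S \<le> exp (l * card S)"
proof -
  have "hc_sum l {} = 1"
    by (simp add: hc_sum_def indeps_def indep_def cong: conj_cong)
  then have "hc_sum l S \<le> (1 + l) ^ card S"
    using hc_sum_Un_le[of "{}" S l] assms by simp
  also have "\<dots> \<le> exp l ^ card S"
    using assms by (intro power_mono) auto
  finally show ?thesis by (simp add: exp_of_nat_mult[symmetric] mult.commute)
qed

text \<open>Double counting of the pairs of an independent set and one of its elements.\<close>

lemma hc_size_eq:
  assumes "finite S"
  shows "hc_size l S = (\<Sum>u\<in>S. l * hc_sum l {w\<in>S. w \<noteq> u \<and> \<not> E u w})"
proof -
  have "hc_size l S = (\<Sum>I\<in>indeps S. \<Sum>u\<in>S. if u \<in> I then l ^ card I else 0)"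
    unfolding hc_size_def
  proof (rule sum.cong[OF refl])
    fix I assume "I \<in> indeps S"
    then have "S \<inter> I = I" by (auto simp: indeps_def)
    then show "l ^ card I * real (card I) = (\<Sum>u\<in>S. if u \<in> I then l ^ card I else 0)"
      using assms by (simp add: sum.If_cases)
  qed
  also have "\<dots> = (\<Sum>u\<in>S. \<Sum>I\<in>indeps S. if u \<in> I then l ^ card I else 0)"
    by (rule sum.swap)
  also have "\<dots> = (\<Sum>u\<in>S. \<Sum>I\<in>{I\<in>indeps S. u \<in> I}. l ^ card I)"
    using assms finite_indeps by (simp add: sum.inter_filter)
  finally show ?thesis using assms by (simp add: hc_sum_containing)
qed

text \<open>
  A vertex \<open>u\<close> lies in the random set with probability \<open>l / (1 + l)\<close> times that of \<open>u\<close> having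
  no chosen neighbour, which is at least \<open>(1 + l) ^ (- deg u) \<ge> 1 - l * deg u\<close>.
\<close>

lemma hc_size_ge:
  fixes l :: real
  assumes "finite S" "0 \<le> l"
  shows "hc_sum l S * (l / (1 + l)) * (real (card S) - l * real (\<Sum>u\<in>S. card {w\<in>S. E u w})) \<le> hc_size l S"
proof -
  have main: "hc_sum l S * (l / (1 + l)) * (1 - l * card {w\<in>S. E u w})
      \<le> l * hc_sum l {w\<in>S. w \<noteq> u \<and> \<not> E u w}" if "u \<in> S" for u
  proof -
    define k where "k = card {w\<in>S. E u w}"
    define z where "z = hc_sum l {w\<in>S. w \<noteq> u \<and> \<not> E u w}"
    have z: "1 \<le> z" unfolding z_def using assms by (intro hc_sum_pos) auto
    \<comment> \<open>\<open>S\<close> splits into the vertices still available once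
      \<open>u\<close> is chosen and the \<open>k + 1\<close> vertices of the closed neighbourhood
      of \<open>u\<close>, each costing a factor of at most \<open>1 + l\<close>.\<close>
    have "{w\<in>S. w \<noteq> u \<and> \<not> E u w} \<union> insert u {w\<in>S. E u w} = S"
      using that by auto
    moreover have "card (insert u {w\<in>S. E u w}) = Suc k"
      using assms E_irrefl unfolding k_def by simp
    ultimately have 1: "hc_sum l S \<le> (1 + l) ^ Suc k * z"
      unfolding z_def using hc_sum_Un_le[of "{w\<in>S. w \<noteq> u \<and> \<not> E u w}" "insert u {w\<in>S. E u w}" l] assms
      by simp
    have Z: "1 \<le> hc_sum l S" using hc_sum_pos assms by simp
    \<comment> \<open>If \<open>1 - l * k\<close> is not positive, neither is the left side;
      otherwise it may multiply the bound on \<open>(1 + l) ^ k\<close>.\<close>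
    show ?thesis
    proof (cases "1 - l * k \<le> 0")
      case True
      have "hc_sum l S * (l / (1 + l)) * (1 - l * k) \<le> 0"
        using True Z assms by (intro mult_nonneg_nonpos) auto
      also have "0 \<le> l * z" using z assms by simp
      finally show ?thesis unfolding k_def z_def .
    next
      case False
      have "(1 + l) ^ k \<le> exp l ^ k" using assms by (intro power_mono) auto
      also have "\<dots> = exp (l * k)" by (simp add: exp_of_nat_mult[symmetric] mult.commute)
      finally have a: "(1 + l) ^ k \<le> exp (l * k)" .
      have b: "1 - l * k \<le> exp (- (l * k))" using exp_ge_add_one_self[of "- (l * k)"] by simp
      have c: "(1 + l) ^ k * (1 - l * k) \<le> 1"
      proof -
        have "(1 + l) ^ k * (1 - l * k) \<le> exp (l * k) * exp (- (l * k))"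
          using a b False assms by (intro mult_mono) auto
        then show ?thesis by (simp add: exp_minus)
      qed
      have "hc_sum l S * (l / (1 + l)) * (1 - l * k)
          \<le> ((1 + l) ^ Suc k * z) * (l / (1 + l)) * (1 - l * k)"
        using 1 False assms by (intro mult_right_mono) auto
      also have "\<dots> = (l * z) * ((1 + l) ^ k * (1 - l * k))"
        using assms by (simp add: field_simps)
      also have "\<dots> \<le> (l * z) * 1"
        using c z assms by (intro mult_left_mono) auto
      finally show ?thesis unfolding k_def z_def by simp
    qed
  qed
  have "hc_sum l S * (l / (1 + l)) * (real (card S) - l * real (\<Sum>u\<in>S. card {w\<in>S. E u w}))
     = (\<Sum>u\<in>S. hc_sum l S * (l / (1 + l)) * (1 - l * card {w\<in>S. E u w}))"
    by (simp only: sum_distrib_left[symmetric]) (simp add: sum_distrib_left sum_subtractf)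
  also have "\<dots> \<le> hc_size l S"
    unfolding hc_size_eq[OF assms(1)] by (intro sum_mono main)
  finally show ?thesis .
qed

section \<open>Conditioning on the sample outside a closed neighbourhood\<close>

lemma indeps_fibre:
  assumes "v \<in> U" and N: "N = {u\<in>U. E v u}" and H: "H \<in> indeps (U - insert v N)"
  defines "S \<equiv> {u\<in>N. \<forall>h\<in>H. \<not> E u h}"
  shows "{I\<in>indeps U. I - insert v N = H} = insert (insert v H) ((\<union>) H ` indeps S)"
proof (intro set_eqI iffI)
  fix I assume I: "I \<in> {I\<in>indeps U. I - insert v N = H}"
  then have ind: "I \<subseteq> U" "indep I" "I - insert v N = H" by (auto simp: indeps_def)
  show "I \<in> insert (insert v H) ((\<union>) H ` indeps S)"
  proof (cases "v \<in> I")
    case True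
    then have "I \<inter> N = {}" using ind N by (auto simp: indep_def)
    then have "I = insert v H" using ind True by auto
    then show ?thesis by simp
  next
    case False
    then have "I = H \<union> (I \<inter> N)" using ind by auto
    moreover have "I \<inter> N \<in> indeps S"
      using ind unfolding S_def by (auto simp: indeps_def indep_def)
    ultimately show ?thesis by blast
  qed
next
  fix I assume "I \<in> insert (insert v H) ((\<union>) H ` indeps S)"
  then consider "I = insert v H" | J where "J \<in> indeps S" "I = H \<union> J" by auto
  then show "I \<in> {I\<in>indeps U. I - insert v N = H}"
  proof cases
    case 1
    then show ?thesis using H assms(1) E_irrefl unfolding N
      by (auto simp: indeps_def indep_def dest: E_sym)
  next
    case 2
    have "H \<union> J \<in> indeps U"
      using 2 H E_sym unfolding S_def N indeps_def indep_def by blast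
    moreover have "v \<notin> N" using E_irrefl N by simp
    then have "H \<union> J - insert v N = H"
      using 2 H unfolding S_def by (auto simp: indeps_def)
    ultimately show ?thesis using 2 by simp
  qed
qed

text \<open>The independent sets with a fixed part \<open>H\<close> outside the closed neighbourhood
  of \<open>v\<close> form a fibre. Up to the factor \<open>l ^ card H\<close> its weight is
  \<open>l + hc_sum l S\<close> and its weighted value \<open>a * l + hc_size l S\<close>, where
  \<open>S\<close> is the set of unblocked neighbours. So \<open>loc\<close> is the inequality on
  one fibre, and summing over \<open>H\<close> gives the claim.\<close>

lemma hc_local_bound:
  assumes "finite U" "v \<in> U" "0 \<le> l" and N: "N = {u\<in>U. E v u}"
    and loc: "\<And>S. S \<subseteq> N \<Longrightarrow> \<kappa> * (l + hc_sum l S) \<le> a * l + hc_size l S"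
  shows "\<kappa> * hc_sum l U \<le> (\<Sum>I\<in>indeps U. l ^ card I * (a * of_bool (v \<in> I) + card (N \<inter> I)))"
proof -
  let ?f = "\<lambda>I. l ^ card I * (a * of_bool (v \<in> I) + card (N \<inter> I))"
  let ?g = "\<lambda>I. I - insert v N"
  let ?HH = "indeps (U - insert v N)"
  have fin: "finite (indeps U)" "finite ?HH" using assms finite_indeps by auto
  have g: "?g ` indeps U \<subseteq> ?HH" by (auto simp: indeps_def indep_def)
  have vN: "v \<notin> N" using E_irrefl N by simp
  have "(\<Sum>I\<in>{I\<in>indeps U. ?g I = H}. \<kappa> * l ^ card I) \<le> (\<Sum>I\<in>{I\<in>indeps U. ?g I = H}. ?f I)"
    if H: "H \<in> ?HH" for H
  proof -
    define S where "S = {u\<in>N. \<forall>h\<in>H. \<not> E u h}"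
    have SN: "S \<subseteq> N" by (auto simp: S_def)
    have finN: "finite N" using assms by auto
    have finS: "finite S" using SN finN finite_subset by blast
    have finH: "finite H" using H assms by (auto simp: indeps_def intro: finite_subset)
    have HN: "H \<inter> N = {}" "v \<notin> H" using H by (auto simp: indeps_def)
    have fib: "{I\<in>indeps U. ?g I = H} = insert (insert v H) ((\<union>) H ` indeps S)"
      unfolding S_def by (rule indeps_fibre[OF assms(2) N H])
    have inj: "inj_on ((\<union>) H) (indeps S)"
    proof (rule inj_onI)
      fix J K assume "J \<in> indeps S" "K \<in> indeps S" and eq: "H \<union> J = H \<union> K"
      then have "J \<inter> H = {}" "K \<inter> H = {}" using SN HN by (auto simp: indeps_def)
      then show "J = K" using eq by blast
    qed
    have notin: "insert v H \<notin> (\<union>) H ` indeps S"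
      using SN vN HN by (auto simp: indeps_def)
    have split: "(\<Sum>I\<in>{I\<in>indeps U. ?g I = H}. F I) = F (insert v H) + (\<Sum>J\<in>indeps S. F (H \<union> J))"
      for F :: "'a set \<Rightarrow> real"
      unfolding fib using notin finite_indeps[OF finS] by (simp add: sum.reindex[OF inj])
    have J: "card (H \<union> J) = card H + card J" "N \<inter> (H \<union> J) = J" "v \<notin> H \<union> J"
      if "J \<in> indeps S" for J
    proof -
      have JS: "J \<subseteq> S" using that by (auto simp: indeps_def)
      then show "card (H \<union> J) = card H + card J"
        using HN SN finH finS finite_subset[of J S] by (intro card_Un_disjoint) auto
      show "N \<inter> (H \<union> J) = J" "v \<notin> H \<union> J" using JS SN HN vN by auto
    qed
    have Nv: "N \<inter> insert v H = {}" using HN vN by auto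
    have "(\<Sum>I\<in>{I\<in>indeps U. ?g I = H}. \<kappa> * l ^ card I)
        = \<kappa> * l ^ card (insert v H) + (\<Sum>J\<in>indeps S. \<kappa> * l ^ card (H \<union> J))"
      by (rule split)
    also have "(\<Sum>J\<in>indeps S. \<kappa> * l ^ card (H \<union> J)) = (\<Sum>J\<in>indeps S. l ^ card H * \<kappa> * l ^ card J)"
      by (rule sum.cong) (auto simp: J power_add)
    also have "\<kappa> * l ^ card (insert v H) + \<dots> = l ^ card H * (\<kappa> * (l + hc_sum l S))"
      using finH HN by (simp add: hc_sum_def sum_distrib_left algebra_simps)
    also have "\<dots> \<le> l ^ card H * (a * l + hc_size l S)"
      using loc[OF SN] assms by (intro mult_left_mono) auto
    also have "\<dots> = ?f (insert v H) + (\<Sum>J\<in>indeps S. l ^ card H * (l ^ card J * card J))"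
      using finH HN Nv by (simp add: hc_size_def sum_distrib_left algebra_simps)
    also have "(\<Sum>J\<in>indeps S. l ^ card H * (l ^ card J * card J)) = (\<Sum>J\<in>indeps S. ?f (H \<union> J))"
    proof (rule sum.cong[OF refl])
      fix K assume "K \<in> indeps S"
      note K = J[OF this]
      have b: "of_bool (v \<in> H \<union> K) = (0::real)" using K(3) by simp
      show "l ^ card H * (l ^ card K * card K) = ?f (H \<union> K)"
        unfolding b K(1,2) power_add by simp
    qed
    also have "?f (insert v H) + \<dots> = (\<Sum>I\<in>{I\<in>indeps U. ?g I = H}. ?f I)"
      by (rule split[symmetric])
    finally show ?thesis .
  qed
  then have "(\<Sum>H\<in>?HH. \<Sum>I\<in>{I\<in>indeps U. ?g I = H}. \<kappa> * l ^ card I)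
      \<le> (\<Sum>H\<in>?HH. \<Sum>I\<in>{I\<in>indeps U. ?g I = H}. ?f I)"
    by (rule sum_mono)
  then show ?thesis
    unfolding sum.group[OF fin g] by (simp add: hc_sum_def sum_distrib_left)
qed

text \<open>Sum the local bound over \<open>v\<close> and exchange the sums. For fixed
  \<open>I\<close>, its own vertices contribute \<open>a * card I\<close>; the pairs of a vertex and
  a neighbour in \<open>I\<close>, counted from the end in \<open>I\<close>, contribute at most as
  much again. Finally divide by \<open>hc_sum l U\<close>.\<close>

lemma independence_lower_bound:
  fixes a \<kappa> :: real
  assumes "finite U" "0 < l"
    and deg: "\<And>v. v \<in> U \<Longrightarrow> card {u\<in>U. E v u} \<le> a"
    and loc: "\<And>v S. v \<in> U \<Longrightarrow> S \<subseteq> {u\<in>U. E v u} \<Longrightarrow> \<kappa> * (l + hc_sum l S) \<le> a * l + hc_size l S"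
    and max: "\<And>I. I \<in> indeps U \<Longrightarrow> real (card I) \<le> \<alpha>"
    and "0 \<le> a"
  shows "\<kappa> * card U \<le> 2 * a * \<alpha>"
proof -
  let ?N = "\<lambda>v. {u\<in>U. E v u}"
  let ?f = "\<lambda>v I. l ^ card I * (a * of_bool (v \<in> I) + card (?N v \<inter> I))"
  have each: "(\<Sum>v\<in>U. ?f v I) \<le> l ^ card I * (2 * a * \<alpha>)" if I: "I \<in> indeps U" for I
  proof -
    have IU: "I \<subseteq> U" "finite I" using I assms by (auto simp: indeps_def intro: finite_subset)
    have "(\<Sum>v\<in>U. of_bool (v \<in> I)) = real (card I)"
      using IU assms by (simp add: of_bool_def sum.If_cases Int_absorb1)
    then have 1: "(\<Sum>v\<in>U. a * of_bool (v \<in> I)) = a * card I"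
      by (simp add: sum_distrib_left[symmetric])
    have "(\<Sum>v\<in>U. card (?N v \<inter> I)) = (\<Sum>v\<in>U. card {u\<in>I. E v u})"
      using IU by (intro sum.cong refl arg_cong[where f=card]) auto
    also have "\<dots> = (\<Sum>u\<in>I. card {v\<in>U. E v u})"
      using sum_multicount_gen[of U I "\<lambda>v u. E v u" "\<lambda>u. card {v\<in>U. E v u}"] IU assms(1) by simp
    also have "\<dots> = (\<Sum>u\<in>I. card (?N u))"
      using E_sym by (intro sum.cong refl arg_cong[where f=card]) auto
    finally have "real (\<Sum>v\<in>U. card (?N v \<inter> I)) = (\<Sum>u\<in>I. real (card (?N u)))" by simp
    also have "\<dots> \<le> (\<Sum>u\<in>I. a)" using deg IU by (intro sum_mono) auto
    finally have 2: "(\<Sum>v\<in>U. real (card (?N v \<inter> I))) \<le> a * card I" by (simp add: mult.commute)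
    have "(\<Sum>v\<in>U. ?f v I) = l ^ card I * ((\<Sum>v\<in>U. a * of_bool (v \<in> I)) + (\<Sum>v\<in>U. real (card (?N v \<inter> I))))"
      by (simp add: sum_distrib_left[symmetric] sum.distrib)
    also have "\<dots> \<le> l ^ card I * (2 * a * card I)"
      using 1 2 assms by (intro mult_left_mono) auto
    also have "\<dots> \<le> l ^ card I * (2 * a * \<alpha>)"
      using max[OF I] assms by (intro mult_left_mono) auto
    finally show ?thesis .
  qed
  have "card U * (\<kappa> * hc_sum l U) = (\<Sum>v\<in>U. \<kappa> * hc_sum l U)" by simp
  also have "\<dots> \<le> (\<Sum>v\<in>U. \<Sum>I\<in>indeps U. ?f v I)"
    using assms by (intro sum_mono hc_local_bound) auto
  also have "\<dots> = (\<Sum>I\<in>indeps U. \<Sum>v\<in>U. ?f v I)" by (rule sum.swap)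
  also have "\<dots> \<le> (\<Sum>I\<in>indeps U. l ^ card I * (2 * a * \<alpha>))" by (intro sum_mono each)
  also have "\<dots> = hc_sum l U * (2 * a * \<alpha>)" by (simp add: hc_sum_def sum_distrib_right)
  finally have "hc_sum l U * (\<kappa> * card U) \<le> hc_sum l U * (2 * a * \<alpha>)"
    by (simp add: mult.commute mult.left_commute)
  moreover have "0 < hc_sum l U" using hc_sum_pos[of U l] assms by simp
  ultimately show ?thesis by simp
qed

text \<open>The closed neighbourhoods of a largest independent set cover \<open>U\<close>, since an
  uncovered vertex could be added. The strict degree bound leaves room for the centre in each of
  them.\<close>

lemma maximal_indep_bound:
  assumes "finite U" and deg: "\<And>v. v \<in> U \<Longrightarrow> card {u\<in>U. E v u} < a"
    and I: "I \<in> indeps U" and max: "\<And>J. J \<in> indeps U \<Longrightarrow> card J \<le> card I"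
  shows "card U \<le> card I * a"
proof -
  have IU: "I \<subseteq> U" "finite I" using I assms by (auto simp: indeps_def intro: finite_subset)
  have "U \<subseteq> (\<Union>v\<in>I. insert v {u\<in>U. E v u})"
  proof
    fix u assume u: "u \<in> U"
    show "u \<in> (\<Union>v\<in>I. insert v {u\<in>U. E v u})"
    proof (rule ccontr)
      assume neg: "u \<notin> (\<Union>v\<in>I. insert v {u\<in>U. E v u})"
      then have "insert u I \<in> indeps U"
        using I u E_irrefl by (auto simp: indeps_def indep_def dest: E_sym)
      from max[OF this] show False using neg IU by auto
    qed
  qed
  then have "card U \<le> card (\<Union>v\<in>I. insert v {u\<in>U. E v u})"
    using IU assms by (intro card_mono) auto
  also have "\<dots> \<le> (\<Sum>v\<in>I. card (insert v {u\<in>U. E v u}))" using IU by (intro card_UN_le)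
  also have "\<dots> \<le> (\<Sum>v\<in>I. a)"
  proof (rule sum_mono)
    fix v assume "v \<in> I"
    with IU have "v \<in> U" by auto
    from deg[OF this] show "card (insert v {u\<in>U. E v u}) \<le> a"
      using card_insert_le_m1[of a "{u\<in>U. E v u}" v] by linarith
  qed
  finally show ?thesis by simp
qed

text \<open>The choice of \<open>l\<close> makes \<open>a * l\<close> equal to
  \<open>2 powr L / 8\<close> and keeps the loss caused by edges inside \<open>S\<close> below a
  constant independent of \<open>q\<close>.\<close>

lemma hc_weighted_bound:
  fixes a q :: real
  defines "L \<equiv> log 2 (a / sqrt q)" and "l \<equiv> 1 / (8 * sqrt q)"
  assumes "finite S" "0 < a" "1 / 6 \<le> q" "10 \<le> L"
    and edges: "real (\<Sum>u\<in>S. card {w\<in>S. E u w}) \<le> 6 * q"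
  shows "L / 5 * (l + hc_sum l S) \<le> a * l + hc_size l S"
proof -
  define x where "x = l * card S"
  define D where "D = real (\<Sum>u\<in>S. card {w\<in>S. E u w})"
  have q: "0 < q" using assms by simp
  \<comment> \<open>The square of 3/8 is 9/64, which is below 1/6; this yields
    \<open>l \<le> 1 / 3\<close>.\<close>
  have "3 / 8 \<le> sqrt q" using assms by (intro real_le_rsqrt) (simp add: power2_eq_square)
  then have l: "0 < l" "l \<le> 1 / 3" using q unfolding l_def by (auto simp: field_simps)
  have "l * (l * D) \<le> l * (l * (6 * q))"
    using edges l unfolding D_def by (intro mult_left_mono) auto
  also have "\<dots> = 3 / 32" using q unfolding l_def by (simp add: field_simps)
  finally have lD: "l * (l * D) \<le> 3 / 32" .
  have "2 powr L = a / sqrt q" using assms q unfolding L_def by simp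
  then have al: "a * l = 2 powr L / 8" unfolding l_def by simp
  define Z where "Z = hc_sum l S"
  have Z1: "1 \<le> Z" unfolding Z_def using hc_sum_pos assms(3) l by simp
  \<comment> \<open>For small \<open>x\<close> the partition function is at most
    \<open>exp (2 / 5 * L)\<close> and the term \<open>a * l\<close> alone suffices; for large
    \<open>x\<close> the term \<open>hc_size l S\<close> alone does.\<close>
  show ?thesis
  proof (cases "x \<le> 2 / 5 * L")
    case True
    have "Z \<le> exp x" unfolding Z_def x_def using hc_sum_le_exp assms(3) l by simp
    also have "\<dots> \<le> exp (2 / 5 * L)" using True by simp
    finally have "l + Z \<le> 1 / 3 + exp (2 / 5 * L)" using l by simp
    then have "L / 5 * (l + Z) \<le> L / 5 * (1 / 3 + exp (2 / 5 * L))"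
      using \<open>10 \<le> L\<close> by (intro mult_left_mono) simp_all
    also have "\<dots> \<le> 2 powr L / 8" using assms by (intro exp_vs_two_powr)
    also have "\<dots> \<le> a * l + hc_size l S"
      unfolding al using l by (simp add: hc_size_def sum_nonneg)
    finally show ?thesis unfolding Z_def .
  next
    case False
    \<comment> \<open>Both uses of 4/3 come from \<open>l \<le> 1 / 3\<close>:
      \<open>l + Z \<le> 4 / 3 * Z\<close> and \<open>1 + l \<le> 4 / 3\<close>.\<close>
    have "L / 5 * (4 / 3) \<le> 3 / 4 * (2 / 5 * L - 3 / 32)" using assms by simp
    also have "\<dots> \<le> 3 / 4 * (x - 3 / 32)" using False by simp
    also have "\<dots> = (x - 3 / 32) / (4 / 3)" by simp
    also have "\<dots> \<le> (x - 3 / 32) / (1 + l)"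
      using l False \<open>10 \<le> L\<close> by (intro divide_left_mono) auto
    finally have k: "L / 5 * (4 / 3) \<le> (x - 3 / 32) / (1 + l)" .
    have "L / 5 * (l + Z) \<le> L / 5 * (4 / 3 * Z)"
      using \<open>10 \<le> L\<close> l Z1 by (intro mult_left_mono) linarith+
    also have "\<dots> \<le> Z * ((x - 3 / 32) / (1 + l))"
      using mult_left_mono[OF k, of Z] Z1 by (simp add: mult_ac)
    also have "\<dots> \<le> Z * ((x - l * (l * D)) / (1 + l))"
      using lD l Z1 by (intro mult_left_mono divide_right_mono) auto
    also have "\<dots> = Z * (l / (1 + l)) * (card S - l * D)"
      unfolding x_def by (simp add: field_simps)
    also have "\<dots> \<le> hc_size l S"
      using hc_size_ge[of S l] assms(3) l unfolding Z_def D_def by simp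
    also have "\<dots> \<le> a * l + hc_size l S" unfolding al by simp
    finally show ?thesis unfolding Z_def .
  qed
qed

end

section \<open>Words and Hamming balls\<close>

definition diff_set :: "bool list \<Rightarrow> bool list \<Rightarrow> nat set" where
  "diff_set x y = {k. k < length x \<and> x ! k \<noteq> y ! k}"

lemma hamming_dist_diff_set: "hamming_dist x y = card (diff_set x y)"
  by (simp add: hamming_dist_def diff_set_def)

lemma finite_diff_set [simp]: "finite (diff_set x y)"
  by (simp add: diff_set_def)

lemma diff_set_commute: "length x = length y \<Longrightarrow> diff_set x y = diff_set y x"
  by (auto simp: diff_set_def)

text \<open>Over a two-letter alphabet, two words differ exactly where one of them, but not both,
  differs from the reference word \<open>x\<close>. Seen from \<open>x\<close>, distances thus
  become sizes of symmetric differences.\<close>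

lemma diff_set_sym_diff:
  "length x = length y \<Longrightarrow> diff_set y z = sym_diff (diff_set x y) (diff_set x z)"
  by (auto simp: diff_set_def)

lemma diff_set_empty_iff: "length x = length y \<Longrightarrow> diff_set x y = {} \<longleftrightarrow> x = y"
  by (auto simp: diff_set_def intro: nth_equalityI)

lemma hamming_dist_zero_iff: "length x = length y \<Longrightarrow> hamming_dist x y = 0 \<longleftrightarrow> x = y"
  by (simp add: hamming_dist_diff_set diff_set_empty_iff)

lemma hamming_dist_commute: "length x = length y \<Longrightarrow> hamming_dist x y = hamming_dist y x"
  by (simp add: hamming_dist_diff_set diff_set_commute)

lemma bij_betw_diff_set:
  assumes "x \<in> binary_words n"
  shows "bij_betw (diff_set x) (binary_words n) (Pow {..<n})"
proof (rule bij_betwI')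
  fix y z assume "y \<in> binary_words n" "z \<in> binary_words n"
  then show "diff_set x y = diff_set x z \<longleftrightarrow> y = z"
    using assms diff_set_sym_diff[of x y z] diff_set_empty_iff[of y z] by (auto simp: binary_words_def)
next
  fix y assume "y \<in> binary_words n"
  then show "diff_set x y \<in> Pow {..<n}" using assms by (auto simp: diff_set_def binary_words_def)
next
  fix Y assume "Y \<in> Pow {..<n}"
  \<comment> \<open>The witness flips the bits of \<open>x\<close> at the positions in
    \<open>Y\<close>; \<open>\<noteq>\<close> acts as exclusive or.\<close>
  then have "Y = diff_set x (map (\<lambda>k. x ! k \<noteq> (k \<in> Y)) [0..<n])"
    using assms by (auto simp: diff_set_def binary_words_def)
  moreover have "map (\<lambda>k. x ! k \<noteq> (k \<in> Y)) [0..<n] \<in> binary_words n"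
    by (simp add: binary_words_def)
  ultimately show "\<exists>y\<in>binary_words n. Y = diff_set x y" by blast
qed

lemma finite_binary_words: "finite (binary_words n)"
  using finite_lists_length_eq[of "UNIV :: bool set" n] by (simp add: binary_words_def)

lemma card_binary_words: "card (binary_words n) = 2 ^ n"
  using card_lists_length_eq[of "UNIV :: bool set" n] by (simp add: binary_words_def)

text \<open>
  \<open>A2\<close> asks for minimum distance exactly \<open>d\<close>: take a closest pair of \<open>C\<close> and move one of its
  words towards the other until they are at distance \<open>d\<close>; the distances from the moved word to
  the remaining ones stay at least \<open>d\<close>.
\<close>

lemma card_le_A2:
  assumes C: "C \<subseteq> binary_words n" "2 \<le> card C" and "1 \<le> d"
    and dist: "\<And>x y. x \<in> C \<Longrightarrow> y \<in> C \<Longrightarrow> x \<noteq> y \<Longrightarrow> d \<le> hamming_dist x y"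
  shows "card C \<le> A2 n d"
proof -
  define P where "P C = {hamming_dist x y | x y. x \<in> C \<and> y \<in> C \<and> x \<noteq> y}" for C
  have finC: "finite C" using C finite_binary_words finite_subset by blast
  have finP: "finite (P B)" if "finite B" for B
  proof -
    have "P B \<subseteq> (\<lambda>(x, y). hamming_dist x y) ` (B \<times> B)" by (auto simp: P_def)
    then show ?thesis using that finite_subset by blast
  qed
  define D where "D = Min (P C)"
  have "P C \<noteq> {}"
  proof -
    obtain x y where "x \<in> C" "y \<in> C" "x \<noteq> y"
      using C card_le_Suc0_iff_eq[OF finC] by (auto simp: not_less_eq_eq numeral_2_eq_2)
    then show ?thesis by (auto simp: P_def)
  qed
  then have "D \<in> P C" unfolding D_def using finP finC by (intro Min_in) auto
  then obtain x y where xy: "x \<in> C" "y \<in> C" "x \<noteq> y" "D = hamming_dist x y"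
    by (auto simp: P_def)
  have D_le: "D \<le> hamming_dist u v" if "u \<in> C" "v \<in> C" "u \<noteq> v" for u v
    unfolding D_def using that finP[OF finC] by (intro Min_le) (auto simp: P_def)
  have dD: "d \<le> D" using dist xy by auto
  have len: "length u = n" if "u \<in> C" for u using that C by (auto simp: binary_words_def)
  \<comment> \<open>The moved word \<open>y'\<close> will differ from \<open>x\<close> exactly on
    \<open>T\<close>, so it agrees with \<open>y\<close> there and lies on a shortest path between
    \<open>x\<close> and \<open>y\<close>.\<close>
  obtain T where T: "T \<subseteq> diff_set x y" "card T = d"
    using obtain_subset_with_card_n[of d "diff_set x y"] dD xy(4) by (auto simp: hamming_dist_diff_set)
  have "T \<in> Pow {..<n}" using T len[OF xy(1)] by (auto simp: diff_set_def)
  then obtain y' where y': "y' \<in> binary_words n" "diff_set x y' = T"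
    using bij_betw_diff_set[of x n] xy(1) C(1) unfolding bij_betw_def by (metis imageE subsetD)
  have len': "length y' = n" using y' by (simp add: binary_words_def)
  have dxy': "hamming_dist x y' = d" using y' T by (simp add: hamming_dist_diff_set)
  have "diff_set y y' = diff_set x y - T"
    using diff_set_sym_diff[of x y y'] len xy T y' by auto
  then have dyy': "hamming_dist y y' = D - d"
    using T xy(4) by (simp add: hamming_dist_diff_set card_Diff_subset finite_subset)
  define C' where "C' = insert y' (C - {y})"
  \<comment> \<open>Minimality of \<open>D\<close> and the triangle inequality give
    \<open>D \<le> hamming_dist y z \<le> (D - d) + hamming_dist y' z\<close>.\<close>
  have far: "d \<le> hamming_dist y' z" if z: "z \<in> C - {y}" for z
  proof -
    have "diff_set y z \<subseteq> diff_set y y' \<union> diff_set y' z"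
      using len len' xy z by (auto simp: diff_set_def)
    then have "card (diff_set y z) \<le> card (diff_set y y' \<union> diff_set y' z)" by (intro card_mono) auto
    also have "\<dots> \<le> card (diff_set y y') + card (diff_set y' z)" by (rule card_Un_le)
    finally have "hamming_dist y z \<le> (D - d) + hamming_dist y' z"
      using dyy' by (simp add: hamming_dist_diff_set)
    then show ?thesis using D_le[of y z] z xy dD by auto
  qed
  \<comment> \<open>Otherwise \<open>far\<close> would put \<open>y'\<close> at positive distance
    from itself. So the exchange of \<open>y\<close> for \<open>y'\<close> keeps the size of the
    code.\<close>
  have "y' \<notin> C - {y}"
  proof
    assume "y' \<in> C - {y}"
    from far[OF this] show False using assms hamming_dist_zero_iff[of y' y'] by simp
  qed
  then have card': "card C' = card C"
    using finC xy card_Suc_Diff1[of C y] by (simp add: C'_def)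
  have "Min (P C') = d"
  proof (rule Min_eqI)
    show "finite (P C')" using finC by (intro finP) (simp add: C'_def)
    have "x \<noteq> y'" using dxy' assms hamming_dist_zero_iff[of x x] by auto
    then show "d \<in> P C'" using dxy' xy by (auto simp: P_def C'_def)
    fix m assume "m \<in> P C'"
    then obtain u v where uv: "u \<in> C'" "v \<in> C'" "u \<noteq> v" "m = hamming_dist u v"
      by (auto simp: P_def)
    consider "u = y'" "v \<in> C - {y}" | "v = y'" "u \<in> C - {y}" | "u \<in> C" "v \<in> C"
      using uv by (auto simp: C'_def)
    then show "d \<le> m"
    proof cases
      case 1 then show ?thesis using far uv by simp
    next
      case 2 then show ?thesis using far uv hamming_dist_commute[of u v] len len' by simp
    next
      case 3 then show ?thesis using dist uv by simp
    qed
  qed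
  then have "binary_code n d C'"
    using C card' y' by (auto simp: binary_code_def min_dist_def P_def C'_def)
  moreover have "finite {C. binary_code n d C}"
    by (rule finite_subset[of _ "Pow (binary_words n)"])
      (auto simp: binary_code_def finite_binary_words)
  ultimately show ?thesis unfolding A2_def using card' by (intro Max_ge) (auto simp: image_iff)
qed

section \<open>Counting the common neighbours of two words\<close>

lemma ceiling_nonneg_le_iff: "ceiling_nonneg x \<le> j \<longleftrightarrow> x \<le> real j"
proof
  have "x \<le> real (ceiling_nonneg x)"
    unfolding ceiling_nonneg_def using real_arch_simple[of x] by (rule LeastI_ex)
  then show "ceiling_nonneg x \<le> j \<Longrightarrow> x \<le> real j" by linarith
qed (simp add: ceiling_nonneg_def Least_le)

lemma card_sym_diff_eq:
  assumes "finite A" "finite B"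
  shows "card (sym_diff A B) + 2 * card (A \<inter> B) = card A + card B"
proof -
  have "card (sym_diff A B) = card (A - B) + card (B - A)"
    using assms by (intro card_Un_disjoint) auto
  moreover have "card A = card (A - B) + card (A \<inter> B)"
    using assms card_Int_Diff[of A B] by simp
  moreover have "card B = card (B - A) + card (A \<inter> B)"
    using assms card_Int_Diff[of B A] by (simp add: Int_commute)
  ultimately show ?thesis by simp
qed

text \<open>The parts of \<open>Y\<close> inside and outside \<open>W\<close> are chosen
  independently.\<close>

lemma card_subsets_meeting:
  assumes "finite S" "W \<subseteq> S" "j \<le> i"
  shows "card {Y. Y \<subseteq> S \<and> card Y = i \<and> card (Y \<inter> W) = j}
    = (card W choose j) * ((card S - card W) choose (i - j))"
proof -
  let ?A = "{A. A \<subseteq> W \<and> card A = j}" and ?B = "{B. B \<subseteq> S - W \<and> card B = i - j}"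
  let ?Y = "{Y. Y \<subseteq> S \<and> card Y = i \<and> card (Y \<inter> W) = j}"
  let ?f = "\<lambda>p :: 'a set \<times> 'a set. fst p \<union> snd p"
  have finW: "finite W" using assms finite_subset by blast
  have union: "A \<union> B \<in> ?Y" if "A \<in> ?A" "B \<in> ?B" for A B
  proof -
    have fin: "finite A" "finite B" using that assms finW by (auto intro: finite_subset)
    have "A \<inter> B = {}" and AW: "(A \<union> B) \<inter> W = A" using that by auto
    then have "card (A \<union> B) = i" using that fin assms(3) by (simp add: card_Un_disjoint)
    moreover have "A \<union> B \<subseteq> S" using that assms(2) by auto
    ultimately show ?thesis using that by (simp add: AW)
  qed
  have split: "Y \<inter> W \<in> ?A" "Y - W \<in> ?B" if "Y \<in> ?Y" for Y
  proof -
    have "card (Y - W) = card Y - card (Y \<inter> W)"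
      using finW by (simp add: card_Diff_subset_Int)
    then show "Y \<inter> W \<in> ?A" "Y - W \<in> ?B" using that by auto
  qed
  have "bij_betw ?f (?A \<times> ?B) ?Y"
  proof (rule bij_betw_byWitness[where f' = "\<lambda>Y. (Y \<inter> W, Y - W)"])
    show "\<forall>p\<in>?A \<times> ?B. (?f p \<inter> W, ?f p - W) = p"
    proof
      fix p assume "p \<in> ?A \<times> ?B"
      then have "fst p \<subseteq> W" "snd p \<inter> W = {}" by auto
      then have "?f p \<inter> W = fst p" "?f p - W = snd p" by blast+
      then show "(?f p \<inter> W, ?f p - W) = p" by simp
    qed
    show "\<forall>Y\<in>?Y. ?f (Y \<inter> W, Y - W) = Y" by (simp add: Int_Diff_Un)
    show "?f ` (?A \<times> ?B) \<subseteq> ?Y"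
    proof (rule image_subsetI)
      fix p assume "p \<in> ?A \<times> ?B"
      then show "?f p \<in> ?Y" by (intro union) (simp_all add: mem_Times_iff)
    qed
    show "(\<lambda>Y. (Y \<inter> W, Y - W)) ` ?Y \<subseteq> ?A \<times> ?B"
      using split by (intro image_subsetI SigmaI)
  qed
  then have "card ?Y = card ?A * card ?B"
    using bij_betw_same_card[of ?f "?A \<times> ?B" ?Y] by (simp only: card_cartesian_product)
  then show ?thesis using assms finW by (simp add: n_subsets card_Diff_subset)
qed

text \<open>If \<open>card Y = i\<close> and \<open>card (Y \<inter> W) = j\<close>, the symmetric
  difference has \<open>w + i - 2 * j\<close> elements, which is at most \<open>r\<close> exactly
  when \<open>j\<close> reaches the lower limit of the inner sum. The final 1 discards
  \<open>Y = W\<close>, where the symmetric difference is empty.\<close>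

lemma card_ball_inter_ball:
  assumes W: "W \<subseteq> {..<n}" "card W = w" "1 \<le> w" "w \<le> r"
  shows "real (card {Y. Y \<subseteq> {..<n} \<and> card Y \<in> {1..r} \<and> card (sym_diff W Y) \<in> {1..r}}) =
    (\<Sum>i = 1..r. \<Sum>j = ceiling_nonneg ((real w + real i - real r) / 2)..min w i.
         real (w choose j) * real ((n - w) choose (i - j))) - 1"
proof -
  let ?F = "{Y. Y \<subseteq> {..<n} \<and> card Y \<in> {1..r} \<and> card (sym_diff W Y) \<le> r}"
  let ?c = "\<lambda>i. ceiling_nonneg ((real w + real i - real r) / 2)"
  let ?P = "Sigma {1..r} (\<lambda>i. {?c i..min w i})"
  let ?G = "\<lambda>i j. {Y. Y \<subseteq> {..<n} \<and> card Y = i \<and> card (Y \<inter> W) = j}"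
  have finW: "finite W" using W finite_subset by blast
  have F: "?F = (\<Union>p\<in>?P. ?G (fst p) (snd p))"
  proof (intro set_eqI iffI)
    fix Y assume Y: "Y \<in> ?F"
    then have finY: "finite Y" using finite_subset by blast
    have "card (sym_diff W Y) + 2 * card (Y \<inter> W) = w + card Y"
      using card_sym_diff_eq[OF finW finY] W by (simp add: Int_commute)
    moreover have "card (Y \<inter> W) \<le> w" "card (Y \<inter> W) \<le> card Y"
      using W finW finY by (auto intro!: card_mono)
    ultimately have "(card Y, card (Y \<inter> W)) \<in> ?P"
      using Y by (auto simp: ceiling_nonneg_le_iff)
    moreover have "Y \<in> ?G (fst (card Y, card (Y \<inter> W))) (snd (card Y, card (Y \<inter> W)))"
      using Y by simp
    ultimately show "Y \<in> (\<Union>p\<in>?P. ?G (fst p) (snd p))" by (rule UN_I)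
  next
    fix Y assume "Y \<in> (\<Union>p\<in>?P. ?G (fst p) (snd p))"
    then have Y: "Y \<subseteq> {..<n}" "card Y \<in> {1..r}" "?c (card Y) \<le> card (Y \<inter> W)" by auto
    then have finY: "finite Y" using finite_subset by blast
    have "card (sym_diff W Y) + 2 * card (Y \<inter> W) = w + card Y"
      using card_sym_diff_eq[OF finW finY] W by (simp add: Int_commute)
    moreover have "real w + real (card Y) - real r \<le> 2 * card (Y \<inter> W)"
      using Y(3) by (simp add: ceiling_nonneg_le_iff)
    ultimately have "card (sym_diff W Y) \<le> r" by linarith
    then show "Y \<in> ?F" using Y by simp
  qed
  have fin: "finite (?G i j)" for i j by (rule finite_subset[of _ "Pow {..<n}"]) auto
  have "card ?F = (\<Sum>p\<in>?P. card (?G (fst p) (snd p)))"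
    unfolding F using fin by (intro card_UN_disjoint) auto
  also have "\<dots> = (\<Sum>p\<in>?P. (w choose (snd p)) * ((n - w) choose (fst p - snd p)))"
    using W by (intro sum.cong refl) (auto simp: card_subsets_meeting)
  also have "\<dots> = (\<Sum>i = 1..r. \<Sum>j = ?c i..min w i. (w choose j) * ((n - w) choose (i - j)))"
    by (subst sum.Sigma) (auto simp: case_prod_beta)
  finally have cF: "real (card ?F)
      = (\<Sum>i = 1..r. \<Sum>j = ?c i..min w i. real (w choose j) * real ((n - w) choose (i - j)))"
    by simp
  have "{Y. Y \<subseteq> {..<n} \<and> card Y \<in> {1..r} \<and> card (sym_diff W Y) \<in> {1..r}} = ?F - {W}"
  proof (intro set_eqI iffI)
    fix Y assume Y: "Y \<in> ?F - {W}"
    then have "finite Y" using finite_subset by blast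
    moreover have "sym_diff W Y \<noteq> {}" using Y by auto
    ultimately have "card (sym_diff W Y) \<noteq> 0" using finW by (simp only: card_eq_0_iff) auto
    then show "Y \<in> {Y. Y \<subseteq> {..<n} \<and> card Y \<in> {1..r} \<and> card (sym_diff W Y) \<in> {1..r}}"
      using Y by auto
  qed auto
  moreover have "W \<in> ?F" using W by simp
  moreover have "finite ?F" by (rule finite_subset[of _ "Pow {..<n}"]) auto
  ultimately have "card ?F = Suc (card {Y. Y \<subseteq> {..<n} \<and> card Y \<in> {1..r} \<and> card (sym_diff W Y) \<in> {1..r}})"
    using card_Suc_Diff1[of ?F W] by simp
  then show ?thesis using cF by simp
qed

lemma sum_subsets_by_card:
  fixes g :: "nat \<Rightarrow> real"
  shows "(\<Sum>W\<in>{W. W \<subseteq> {..<n} \<and> card W \<in> {1..r}}. g (card W)) = (\<Sum>w = 1..r. real (n choose w) * g w)"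
proof -
  let ?S = "{W. W \<subseteq> {..<n} \<and> card W \<in> {1..r}}"
  have "finite ?S" by (rule finite_subset[of _ "Pow {..<n}"]) auto
  then have "(\<Sum>W\<in>?S. g (card W)) = (\<Sum>w\<in>{1..r}. \<Sum>W\<in>{W\<in>?S. card W = w}. g (card W))"
    by (intro sum.group[symmetric]) auto
  also have "\<dots> = (\<Sum>w = 1..r. real (n choose w) * g w)"
  proof (rule sum.cong[OF refl])
    fix w assume "w \<in> {1..r}"
    then have "{W\<in>?S. card W = w} = {W. W \<subseteq> {..<n} \<and> card W = w}" by auto
    then show "(\<Sum>W\<in>{W\<in>?S. card W = w}. g (card W)) = real (n choose w) * g w"
      using n_subsets[of "{..<n}" w] by simp
  qed
  finally show ?thesis .
qed

section \<open>The graph of distinct words at distance at most \<open>r\<close>\<close>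

definition near :: "nat \<Rightarrow> bool list \<Rightarrow> bool list \<Rightarrow> bool" where
  "near r x y \<longleftrightarrow> length x = length y \<and> hamming_dist x y \<in> {1..r}"

lemma sym_rel_near: "sym_rel (near r)"
proof
  fix x y
  show "near r x y \<Longrightarrow> near r y x" by (simp add: near_def hamming_dist_commute)
  show "\<not> near r x x" using hamming_dist_zero_iff[of x x] by (simp add: near_def)
qed

lemma near_neighbours:
  assumes "x \<in> binary_words n"
  shows "bij_betw (diff_set x) {y\<in>binary_words n. near r x y} {Y. Y \<subseteq> {..<n} \<and> card Y \<in> {1..r}}"
proof -
  have "{y\<in>binary_words n. near r x y} = {y\<in>binary_words n. card (diff_set x y) \<in> {1..r}}"
    using assms by (auto simp: near_def binary_words_def hamming_dist_diff_set)
  moreover have "inj_on (diff_set x) {y\<in>binary_words n. card (diff_set x y) \<in> {1..r}}"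
    using bij_betw_diff_set[OF assms] by (auto simp: bij_betw_def intro: inj_on_subset)
  moreover have "diff_set x ` {y\<in>binary_words n. card (diff_set x y) \<in> {1..r}}
      = {Y \<in> diff_set x ` binary_words n. card Y \<in> {1..r}}" by blast
  moreover have "diff_set x ` binary_words n = Pow {..<n}"
    using bij_betw_diff_set[OF assms] by (simp add: bij_betw_def)
  ultimately show ?thesis by (simp add: bij_betw_def)
qed

lemma card_near:
  assumes "x \<in> binary_words n"
  shows "Suc (card {y\<in>binary_words n. near r x y}) = V n r"
proof -
  have "real (card {y\<in>binary_words n. near r x y}) = real (card {Y. Y \<subseteq> {..<n} \<and> card Y \<in> {1..r}})"
    by (simp only: bij_betw_same_card[OF near_neighbours[OF assms]])
  also have "\<dots> = (\<Sum>w = 1..r. real (n choose w))"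
    using sum_subsets_by_card[of "\<lambda>_. 1" n r] by (simp only: sum_constant mult_1_right)
  also have "\<dots> = real (\<Sum>w = 1..r. n choose w)" by simp
  finally have "card {y\<in>binary_words n. near r x y} = (\<Sum>w = 1..r. n choose w)"
    by (simp only: of_nat_eq_iff)
  then show ?thesis unfolding V_def by (simp only: sum.atLeast_Suc_atMost[OF le0]) simp
qed

text \<open>\<open>diff_set x\<close> turns adjacency among neighbours of \<open>x\<close> into a
  condition on symmetric differences, counted by \<open>card_ball_inter_ball\<close>. Each edge is
  seen from both ends, so \<open>x\<close> lies in \<open>3 * e n r\<close> triangles: the graph has
  \<open>e n r\<close> triangles per word.\<close>

lemma near_edges:
  fixes r :: nat
  assumes x: "x \<in> binary_words n"
  defines "N \<equiv> {y\<in>binary_words n. near r x y}"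
  shows "real (\<Sum>u\<in>N. card {w\<in>N. near r u w}) = 6 * e n r"
proof -
  let ?S = "{Y. Y \<subseteq> {..<n} \<and> card Y \<in> {1..r}}"
  let ?T = "\<lambda>W. {Y. Y \<subseteq> {..<n} \<and> card Y \<in> {1..r} \<and> card (sym_diff W Y) \<in> {1..r}}"
  let ?g = "\<lambda>w. (\<Sum>i = 1..r. \<Sum>j = ceiling_nonneg ((real w + real i - real r) / 2)..min w i.
         real (w choose j) * real ((n - w) choose (i - j))) - 1"
  have six: "X = 6 * (1 / 6 * X)" for X :: real by simp
  have bij: "bij_betw (diff_set x) N ?S" unfolding N_def by (rule near_neighbours[OF x])
  have "card {w\<in>N. near r u w} = card (?T (diff_set x u))" if u: "u \<in> N" for u
  proof (rule bij_betw_same_card)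
    have lx: "length x = length v" if "v \<in> N" for v
      using that x by (auto simp: N_def binary_words_def)
    have near_iff: "near r u v \<longleftrightarrow> card (sym_diff (diff_set x u) (diff_set x v)) \<in> {1..r}" if "v \<in> N" for v
      using diff_set_sym_diff[OF lx[OF u], of v] lx[OF u] lx[OF that]
      by (simp add: near_def hamming_dist_diff_set)
    have "inj_on (diff_set x) {w\<in>N. near r u w}"
      using bij by (auto simp: bij_betw_def inj_on_def)
    moreover have "diff_set x ` {w\<in>N. near r u w} = {Y\<in>?S. card (sym_diff (diff_set x u) Y) \<in> {1..r}}"
    proof -
      have "diff_set x ` {w\<in>N. near r u w} = diff_set x ` {w\<in>N. card (sym_diff (diff_set x u) (diff_set x w)) \<in> {1..r}}"
        using near_iff by (intro arg_cong[where f = "(`) (diff_set x)"]) blast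
      also have "\<dots> = {Y\<in>diff_set x ` N. card (sym_diff (diff_set x u) Y) \<in> {1..r}}" by blast
      finally show ?thesis using bij by (simp add: bij_betw_def)
    qed
    ultimately show "bij_betw (diff_set x) {w\<in>N. near r u w} (?T (diff_set x u))"
      by (simp add: bij_betw_def)
  qed
  then have "(\<Sum>u\<in>N. card {w\<in>N. near r u w}) = (\<Sum>u\<in>N. card (?T (diff_set x u)))" by simp
  also have "\<dots> = (\<Sum>W\<in>?S. card (?T W))" by (rule sum.reindex_bij_betw[OF bij])
  finally have "real (\<Sum>u\<in>N. card {w\<in>N. near r u w}) = (\<Sum>W\<in>?S. real (card (?T W)))" by simp
  also have "\<dots> = (\<Sum>W\<in>?S. ?g (card W))"
    by (intro sum.cong refl card_ball_inter_ball) auto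
  also have "\<dots> = (\<Sum>w = 1..r. real (n choose w) * ?g w)" by (rule sum_subsets_by_card)
  also have "\<dots> = 6 * (1 / 6 * \<dots>)" by (rule six)
  finally show ?thesis unfolding e_def .
qed

lemma V_pos: "0 < V n r"
proof -
  have "V n r = (n choose 0) + (\<Sum>i = Suc 0..r. n choose i)"
    unfolding V_def by (rule sum.atLeast_Suc_atMost[OF le0])
  then show ?thesis by simp
qed

theorem theorem1:
  fixes n d :: nat
  assumes "1 \<le> n" and "1 \<le> d" and "d \<le> n"
  shows "real (A2 n d) \<ge> 2 ^ n / real (V n (d - 1)) *
    ((log 2 (real (V n (d - 1))) - log 2 (sqrt (e n (d - 1)))) / 10)"
proof -
  define r where "r = d - 1"
  interpret sym_rel "near r" by (rule sym_rel_near)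
  let ?U = "binary_words n"
  define v where "v = real (V n r)"
  \<comment> \<open>When \<open>e = 0\<close>, the default value \<open>log 2 0 = 0\<close> agrees with \<open>log 2 1\<close>.\<close>
  define q where "q = (if e n r = 0 then 1 else e n r)"
  define x0 where "x0 = replicate n False"
  define x1 where "x1 = replicate n True"
  have x: "x0 \<in> ?U" "x1 \<in> ?U" by (auto simp: x0_def x1_def binary_words_def)
  have finU: "finite ?U" by (rule finite_binary_words)
  have v: "0 < v" using V_pos[of n r] by (simp only: v_def of_nat_0_less_iff)
  \<comment> \<open>\<open>6 * e n r\<close> is a count by \<open>near_edges\<close>, hence zero or
    at least 1.\<close>
  have "1 / 6 \<le> e n r \<or> e n r = 0"
  proof -
    obtain m :: nat where "real m = 6 * e n r" by (rule that, rule near_edges[OF x(1)])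
    then show ?thesis by (cases m) auto
  qed
  then have q: "1 / 6 \<le> q" "e n r \<le> q" by (auto simp: q_def)
  define L where "L = log 2 (v / sqrt q)"
  have "log 2 (sqrt (e n r)) = log 2 (sqrt q)" by (simp add: q_def log_def)
  then have L: "log 2 v - log 2 (sqrt (e n r)) = L"
    using v q unfolding L_def by (simp add: log_divide)
  obtain C where C: "C \<in> indeps ?U" and max: "\<And>J. J \<in> indeps ?U \<Longrightarrow> card J \<le> card C"
  proof -
    have "{} \<in> indeps ?U" by (simp add: indeps_def indep_def)
    then have "Max (card ` indeps ?U) \<in> card ` indeps ?U"
      using finite_indeps[OF finU] by (intro Max_in) auto
    then obtain C where "C \<in> indeps ?U" "card C = Max (card ` indeps ?U)" by auto
    then show thesis using finite_indeps[OF finU] by (intro that[of C]) auto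
  qed
  have CU: "C \<subseteq> ?U" using C by (simp add: indeps_def)
  \<comment> \<open>The two constant words are at distance \<open>n\<close>, more than
    \<open>r\<close>, so a largest independent set has the two words that \<open>binary_code\<close>
    demands.\<close>
  have "{x0, x1} \<in> indeps ?U"
  proof -
    have "diff_set x0 x1 = {..<n}" by (auto simp: diff_set_def x0_def x1_def)
    then have "hamming_dist x0 x1 = n" by (simp add: hamming_dist_diff_set)
    moreover have "r < n" using assms by (simp add: r_def)
    ultimately have "\<not> near r x0 x1" by (simp add: near_def)
    then show ?thesis using x E_irrefl by (auto simp: indeps_def indep_def dest: E_sym)
  qed
  moreover have "x0 \<noteq> x1" using assms by (auto simp: x0_def x1_def)
  ultimately have "2 \<le> card C" using max[of "{x0, x1}"] by simp
  \<comment> \<open>Distinct nonadjacent words are at distance more than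
    \<open>r = d - 1\<close>.\<close>
  moreover have "d \<le> hamming_dist y z" if "y \<in> C" "z \<in> C" "y \<noteq> z" for y z
  proof -
    have "length y = length z" using that CU by (auto simp: binary_words_def)
    moreover have "\<not> near r y z" using C that by (simp add: indeps_def indep_def)
    ultimately show ?thesis
      using hamming_dist_zero_iff[of y z] that assms by (auto simp: near_def r_def)
  qed
  ultimately have A2: "card C \<le> A2 n d" using CU assms by (intro card_le_A2) auto
  have "2 ^ n / v * (L / 10) \<le> card C"
  proof (cases "L \<le> 10")
    \<comment> \<open>Here \<open>L / 10\<close> is at most 1, so the covering bound
      \<open>2 ^ n / v\<close> suffices.\<close>
    case True
    have "card ?U \<le> card C * V n r"
      using finU C max card_near[of _ n r] by (intro maximal_indep_bound) (auto simp: less_eq_Suc_le)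
    then have "2 ^ n \<le> real (card C) * v"
      unfolding v_def card_binary_words by (simp flip: of_nat_mult of_nat_power)
    then have "2 ^ n / v \<le> card C" using v by (simp add: field_simps)
    moreover have "2 ^ n / v * (L / 10) \<le> 2 ^ n / v * 1"
      using True v by (intro mult_left_mono) auto
    ultimately show ?thesis by simp
  next
    case False
    \<comment> \<open>Dividing by \<open>2 * v\<close> turns the 5 into the 10 of the claim.\<close>
    have "L / 5 * card ?U \<le> 2 * v * card C"
    proof (rule independence_lower_bound[where l = "1 / (8 * sqrt q)"])
      fix y assume y: "y \<in> ?U"
      show "real (card {u\<in>?U. near r y u}) \<le> v" using card_near[OF y, of r] by (simp add: v_def)
      fix S assume S: "S \<subseteq> {u\<in>?U. near r y u}"
      let ?N = "{u\<in>?U. near r y u}"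
      have finN: "finite ?N" using finU by simp
      \<comment> \<open>A subset of the neighbourhood spans no more edges than the whole of
        it.\<close>
      have "(\<Sum>u\<in>S. card {w\<in>S. near r u w}) \<le> (\<Sum>u\<in>S. card {w\<in>?N. near r u w})"
        using S finU by (intro sum_mono card_mono) auto
      also have "\<dots> \<le> (\<Sum>u\<in>?N. card {w\<in>?N. near r u w})"
        using S finU by (intro sum_mono2) auto
      finally have "real (\<Sum>u\<in>S. card {w\<in>S. near r u w}) \<le> 6 * q"
        using near_edges[OF y, of r] q(2) by linarith
      then show "L / 5 * (1 / (8 * sqrt q) + hc_sum (1 / (8 * sqrt q)) S)
          \<le> v * (1 / (8 * sqrt q)) + hc_size (1 / (8 * sqrt q)) S"
        unfolding L_def using False v q S finN finite_subset[OF S]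
        by (intro hc_weighted_bound) (auto simp: L_def)
    qed (use finU q v max in auto)
    then show ?thesis using v by (simp add: card_binary_words field_simps)
  qed
  also have "real (card C) \<le> real (A2 n d)" using A2 by simp
  finally show ?thesis unfolding r_def[symmetric] v_def[symmetric] L .
qed

end
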